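(* Let $c\ge 0$, $\tau>0$, $t_0\in\mathbb{R}$, and let $\varphi:[-\tau,0]\to\mathbb{R}$ be continuous with finitely many zeros. Then the initial value problem $$\begin{cases} h'(t)=-\operatorname{sign}(h(t-\tau))+c\cos(2\pi t), & t>t_0,\\ h(t)=\varphi(t-t_0), & t\in[t_0-\tau,t_0],\end{cases}$$ has a unique solution which is continuous, remains bounded for all $t\ge t_0$, and crosses the zero-line infinitely many times.
   Context: Here $\operatorname{sign}(x)=1$ for $x>0$, $\operatorname{sign}(x)=-1$ for $x<0$, and $\operatorname{sign}(0)=0$. A function $h(t)$ is considered to be a solution of the initial value problem if it is continuous for all $t\ge t_0$, satisfies the initial condition for all $t\in[t_0-\tau,t_0]$, and is differentiable and satisfies the differential equation for almost all $t>t_0$. "Crosses the zero-line infinitely many times" means that there are infinitely many $z>t_0$ at which $h$ changes sign, i.e. $h(z)=0$ and there is $\delta>0$ with $h(z_-)h(z_+)<0$ for all $z_-\in(z-\delta,z)$ and $z_+\in(z,z+\delta)$.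
   Formalization: Solutions are additionally required to be locally absolutely continuous on [t0,∞); with only continuity and the equation for almost all t, uniqueness fails, since a Cantor function can be added to a solution just after t0. *)

theory Defs
  imports "HOL-Analysis.Analysis"
begin

text \<open>Absolute continuity of a real function on a compact interval, in the usual
  epsilon-delta form. (The library's constant \<open>absolutely_continuous\<close> is about measures.)
  A pair \<open>(u, v)\<close> in \<open>P\<close> stands for the interval from \<open>u\<close> to \<open>v\<close>.\<close>

definition abs_cont_on_interval :: "(real \<Rightarrow> real) \<Rightarrow> real \<Rightarrow> real \<Rightarrow> bool" where
  "abs_cont_on_interval f a b \<longleftrightarrow>
     (\<forall>\<epsilon>>0. \<exists>\<delta>>0. \<forall>P :: (real \<times> real) set.
        finite P \<and> (\<forall>(u, v)\<in>P. a \<le> u \<and> u < v \<and> v \<le> b) \<and>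
        disjoint_family_on (\<lambda>(u, v). {u<..<v}) P \<and>
        (\<Sum>(u, v)\<in>P. v - u) < \<delta> \<longrightarrow>
        (\<Sum>(u, v)\<in>P. \<bar>f v - f u\<bar>) < \<epsilon>)"

text \<open>Solutions of the initial value problem. The differential equation is required for
  Lebesgue-almost all \<open>t > t0\<close>. As usual for solutions in this sense (Caratheodory), local
  absolute continuity is part of the notion: for functions that are merely continuous and
  almost everywhere differentiable, adding a Cantor function to a solution would destroy
  uniqueness.

  A solution lives on \<open>{t0 - \<tau>..}\<close>; the values of the total function \<open>h\<close> to the left of
  \<open>t0 - \<tau>\<close> are irrelevant.\<close>

definition is_solution ::
  "real \<Rightarrow> real \<Rightarrow> real \<Rightarrow> (real \<Rightarrow> real) \<Rightarrow> (real \<Rightarrow> real) \<Rightarrow> bool" where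
  "is_solution c \<tau> t0 \<phi> h \<longleftrightarrow>
     continuous_on {t0..} h \<and>
     (\<forall>T>t0. abs_cont_on_interval h t0 T) \<and>
     (\<forall>t\<in>{t0 - \<tau>..t0}. h t = \<phi> (t - t0)) \<and>
     (AE t in lebesgue. t > t0 \<longrightarrow>
        (h has_real_derivative (- sgn (h (t - \<tau>)) + c * cos (2 * pi * t))) (at t))"

definition crosses_zero_at :: "(real \<Rightarrow> real) \<Rightarrow> real \<Rightarrow> bool" where
  "crosses_zero_at h z \<longleftrightarrow>
     h z = 0 \<and> (\<exists>\<delta>>0. \<forall>x\<in>{z - \<delta><..<z}. \<forall>y\<in>{z<..<z + \<delta>}. h x * h y < 0)"

end

theory Submission
  imports Defs "HOL-Complex_Analysis.Conformal_Mappings"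
begin

text \<open>The solution is constructed by integrating the equation one delay interval at a time. On an
  interval where \<open>h (t - \<tau>)\<close> has constant sign \<open>\<sigma>\<close>, the function \<open>h t\<close> equals
  \<open>- \<sigma> t + c / (2 \<pi>) sin (2 \<pi> t)\<close> up to a constant; being analytic and not constant, it has finitely
  many zeros on compact intervals, so zeros stay locally finite and the equation holds off a countable
  set. Uniqueness follows step by step because an absolutely continuous function with derivative zero
  almost everywhere is constant. After subtracting \<open>c / (2 \<pi>) sin (2 \<pi> t)\<close> from \<open>h\<close>, the remainder has
  slope \<open>- sgn (h (t - \<tau>))\<close>, so it decreases as soon as it is large, which gives boundedness; and if \<open>h\<close>
  did not change sign any more, it would diverge with slope \<open>-1\<close> or \<open>1\<close>, contradicting that sign.\<close>

section \<open>Absolute continuity\<close>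

lemma abs_cont_on_interval_diff:
  assumes "abs_cont_on_interval f a b" "abs_cont_on_interval g a b"
  shows "abs_cont_on_interval (\<lambda>x. f x - g x) a b"
  unfolding abs_cont_on_interval_def
proof (intro allI impI)
  fix \<epsilon> :: real assume "\<epsilon> > 0"
  then have "\<epsilon> / 2 > 0" by simp
  let ?adm = "\<lambda>\<delta> P. finite P \<and> (\<forall>(u, v)\<in>P. a \<le> u \<and> u < v \<and> v \<le> b) \<and>
        disjoint_family_on (\<lambda>(u, v). {u<..<v}) P \<and> (\<Sum>(u, v)\<in>P. v - u) < \<delta>"
  obtain d1 where d1: "d1 > 0" "\<And>P. ?adm d1 P \<Longrightarrow> (\<Sum>(u, v)\<in>P. \<bar>f v - f u\<bar>) < \<epsilon> / 2"
    using assms(1) \<open>\<epsilon> / 2 > 0\<close> unfolding abs_cont_on_interval_def by meson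
  obtain d2 where d2: "d2 > 0" "\<And>P. ?adm d2 P \<Longrightarrow> (\<Sum>(u, v)\<in>P. \<bar>g v - g u\<bar>) < \<epsilon> / 2"
    using assms(2) \<open>\<epsilon> / 2 > 0\<close> unfolding abs_cont_on_interval_def by meson
  show "\<exists>\<delta>>0. \<forall>P. ?adm \<delta> P \<longrightarrow> (\<Sum>(u, v)\<in>P. \<bar>(f v - g v) - (f u - g u)\<bar>) < \<epsilon>"
  proof (intro exI[of _ "min d1 d2"] conjI allI impI)
    show "min d1 d2 > 0" using d1(1) d2(1) by simp
    fix P assume P: "?adm (min d1 d2) P"
    have "(\<Sum>(u, v)\<in>P. \<bar>(f v - g v) - (f u - g u)\<bar>)
        \<le> (\<Sum>(u, v)\<in>P. \<bar>f v - f u\<bar> + \<bar>g v - g u\<bar>)"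
      by (intro sum_mono) (auto split: prod.split)
    also have "\<dots> = (\<Sum>(u, v)\<in>P. \<bar>f v - f u\<bar>) + (\<Sum>(u, v)\<in>P. \<bar>g v - g u\<bar>)"
      by (simp add: sum.distrib[symmetric] case_prod_unfold)
    also have "\<dots> < \<epsilon> / 2 + \<epsilon> / 2"
      using P by (intro add_strict_mono d1(2) d2(2)) auto
    finally show "(\<Sum>(u, v)\<in>P. \<bar>(f v - g v) - (f u - g u)\<bar>) < \<epsilon>" by simp
  qed
qed

lemma abs_cont_on_interval_lipschitz:
  assumes "\<And>u v. a \<le> u \<Longrightarrow> u \<le> v \<Longrightarrow> v \<le> b \<Longrightarrow> \<bar>f v - f u\<bar> \<le> L * (v - u)"
  shows "abs_cont_on_interval f a b"
  unfolding abs_cont_on_interval_def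
proof (intro allI impI)
  fix \<epsilon> :: real assume "\<epsilon> > 0"
  show "\<exists>\<delta>>0. \<forall>P. finite P \<and> (\<forall>(u, v)\<in>P. a \<le> u \<and> u < v \<and> v \<le> b) \<and>
        disjoint_family_on (\<lambda>(u, v). {u<..<v}) P \<and> (\<Sum>(u, v)\<in>P. v - u) < \<delta> \<longrightarrow>
        (\<Sum>(u, v)\<in>P. \<bar>f v - f u\<bar>) < \<epsilon>"
  \<comment> \<open>The constant \<open>\<bar>L\<bar> + 1\<close> replaces \<open>L\<close> so that
    the quotient is positive whatever the value and sign of \<open>L\<close>.\<close>
  proof (intro exI[of _ "\<epsilon> / (\<bar>L\<bar> + 1)"] conjI allI impI)
    show "\<epsilon> / (\<bar>L\<bar> + 1) > 0" using \<open>\<epsilon> > 0\<close> by (simp add: add_nonneg_pos)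
    fix P assume P: "finite P \<and> (\<forall>(u, v)\<in>P. a \<le> u \<and> u < v \<and> v \<le> b) \<and>
        disjoint_family_on (\<lambda>(u, v). {u<..<v}) P \<and> (\<Sum>(u, v)\<in>P. v - u) < \<epsilon> / (\<bar>L\<bar> + 1)"
    have "(\<Sum>(u, v)\<in>P. \<bar>f v - f u\<bar>) \<le> (\<Sum>(u, v)\<in>P. (\<bar>L\<bar> + 1) * (v - u))"
    proof (intro sum_mono, clarify)
      fix u v assume "(u, v) \<in> P"
      then have uv: "a \<le> u" "u < v" "v \<le> b" using P by auto
      then have "\<bar>f v - f u\<bar> \<le> L * (v - u)" using assms by simp
      also have "\<dots> \<le> (\<bar>L\<bar> + 1) * (v - u)" using uv by (intro mult_right_mono) auto
      finally show "\<bar>f v - f u\<bar> \<le> (\<bar>L\<bar> + 1) * (v - u)" .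
    qed
    also have "\<dots> = (\<bar>L\<bar> + 1) * (\<Sum>(u, v)\<in>P. v - u)"
      by (simp add: sum_distrib_left case_prod_unfold)
    also have "\<dots> < \<epsilon>" using P by (simp add: field_simps add_nonneg_pos)
    finally show "(\<Sum>(u, v)\<in>P. \<bar>f v - f u\<bar>) < \<epsilon>" .
  qed
qed

text \<open>A division that is fine for a suitable gauge splits into intervals tagged outside \<open>N\<close>, where
  the derivative controls the increment, and intervals tagged in \<open>N\<close>, which lie in an open set of
  small measure, so that absolute continuity applies.\<close>

lemma abs_cont_zero_derivative_imp_eq:
  fixes f :: "real \<Rightarrow> real"
  assumes ac: "abs_cont_on_interval f a b" and "a \<le> b" and N: "negligible N"
    and deriv: "\<And>x. x \<in> {a..b} - N \<Longrightarrow> (f has_real_derivative 0) (at x)"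
  shows "f b = f a"
proof -
  have small: "\<bar>f b - f a\<bar> \<le> \<epsilon> + \<epsilon> * (b - a)" if "\<epsilon> > 0" for \<epsilon>
  proof -
    obtain \<delta> where "\<delta> > 0" and \<delta>: "\<And>P. finite P \<Longrightarrow> (\<forall>(u, v)\<in>P. a \<le> u \<and> u < v \<and> v \<le> b) \<Longrightarrow>
        disjoint_family_on (\<lambda>(u, v). {u<..<v}) P \<Longrightarrow> (\<Sum>(u, v)\<in>P. v - u) < \<delta> \<Longrightarrow>
        (\<Sum>(u, v)\<in>P. \<bar>f v - f u\<bar>) < \<epsilon>"
      using ac \<open>\<epsilon> > 0\<close> unfolding abs_cont_on_interval_def by meson
    have "N \<in> sets lebesgue" using N negligible_imp_sets by blast
    then obtain U where U: "open U" "N \<subseteq> U" "U - N \<in> lmeasurable" "emeasure lebesgue (U - N) < ennreal \<delta>"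
      using sets_lebesgue_outer_open[OF _ \<open>\<delta> > 0\<close>] by metis
    have NU: "U = (U - N) \<union> N" using U by auto
    have Um: "U \<in> lmeasurable"
      by (subst NU, rule fmeasurable.Un) (use U N negligible_imp_measurable in auto)
    have "measure lebesgue U = measure lebesgue (U - N)"
      using N measure_Un_null_set[of "U - N" lebesgue N] U NU
      by (metis fmeasurableD negligible_iff_null_sets)
    also have "\<dots> < \<delta>"
      using U(3,4) \<open>\<delta> > 0\<close> by (simp add: emeasure_eq_measure2 ennreal_less_iff)
    finally have Ud: "measure lebesgue U < \<delta>" .
    \<comment> \<open>These radii define the gauge: in \<open>N\<close> the ball stays inside the
      small open set, at the other points of the interval the zero derivative bounds increments by
      \<open>\<epsilon>\<close> times the distance. Points of neither kind get radius 1.\<close>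
    have "\<exists>r>0. (x \<in> N \<longrightarrow> ball x r \<subseteq> U) \<and>
       (x \<in> {a..b} - N \<longrightarrow> (\<forall>y\<in>ball x r. \<bar>f y - f x\<bar> \<le> \<epsilon> * \<bar>y - x\<bar>))" for x
    proof (cases "x \<in> {a..b} - N")
      case True
      then have "(f has_derivative (\<lambda>h. 0)) (at x)"
        using deriv[of x] by (simp add: has_field_derivative_def lambda_zero)
      then obtain d where "d > 0" "\<And>y. \<bar>y - x\<bar> < d \<Longrightarrow> \<bar>f y - f x\<bar> \<le> \<epsilon> * \<bar>y - x\<bar>"
        using \<open>\<epsilon> > 0\<close> unfolding has_derivative_within_alt by auto
      then show ?thesis
        using True by (intro exI[of _ d]) (simp add: dist_real_def abs_minus_commute)
    next
      case False
      then show ?thesis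
        using U(1,2) open_contains_ball by (cases "x \<in> N") (blast intro: zero_less_one)+
    qed
    then obtain r where r: "\<And>x. r x > 0" "\<And>x. x \<in> N \<Longrightarrow> ball x (r x) \<subseteq> U"
      "\<And>x y. x \<in> {a..b} - N \<Longrightarrow> y \<in> ball x (r x) \<Longrightarrow> \<bar>f y - f x\<bar> \<le> \<epsilon> * \<bar>y - x\<bar>"
      by metis
    have "gauge (\<lambda>x. ball x (r x))" using r(1) by (simp add: gauge_ball_dependent)
    then obtain p where p: "p tagged_division_of {a..b}" "(\<lambda>x. ball x (r x)) fine p"
      using fine_division_exists_real by blast
    have K: "K = {Inf K..Sup K} \<and> Inf K \<le> x \<and> x \<le> Sup K \<and> a \<le> Inf K \<and> Sup K \<le> b
       \<and> x \<in> {a..b} \<and> K \<subseteq> ball x (r x)" if xK: "(x, K) \<in> p" for x K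
    proof -
      obtain u v where uv: "K = cbox u v" using tagged_division_ofD(4)[OF p(1) xK] by blast
      have "x \<in> K" "K \<subseteq> {a..b}" using tagged_division_ofD(2,3)[OF p(1) that] by auto
      then show ?thesis using uv p(2) that by (auto simp: fine_def)
    qed
    \<comment> \<open>Degenerate intervals are left out of \<open>q\<close>: absolute continuity
      speaks of pairs with \<open>u < v\<close>, and distinct elements of \<open>q\<close> then have
      distinct endpoint pairs. They remain in \<open>p - q\<close>, where their increment is
      zero.\<close>
    define q where "q = {(x, K) \<in> p. x \<in> N \<and> Inf K < Sup K}"
    define e where "e = (\<lambda>(x :: real, K :: real set). (Inf K, Sup K))"
    have finp: "finite p" by (rule tagged_division_of_finite[OF p(1)])
    have qp: "q \<subseteq> p" by (auto simp: q_def)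
    have finq: "finite q" using finp qp finite_subset by blast
    have disj: "{Inf K<..<Sup K} \<inter> {Inf K'<..<Sup K'} = {}"
      if "(x, K) \<in> p" "(x', K') \<in> p" "(x, K) \<noteq> (x', K')" for x K x' K'
    proof -
      have "interior K \<inter> interior K' = {}"
        by (rule tagged_division_ofD(5)[OF p(1) that])
      moreover have "interior K = {Inf K<..<Sup K}" "interior K' = {Inf K'<..<Sup K'}"
        using arg_cong[OF conjunct1[OF K[OF that(1)]], of interior]
          arg_cong[OF conjunct1[OF K[OF that(2)]], of interior] by simp_all
      ultimately show ?thesis by simp
    qed
    have inj: "inj_on e q"
    proof (intro inj_onI, clarify, rule ccontr)
      fix x K x' K' assume A: "(x, K) \<in> q" "(x', K') \<in> q" "e (x, K) = e (x', K')" "\<not> (x = x' \<and> K = K')"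
      \<comment> \<open>Two different elements with the same endpoints would make a nonempty open
        interval disjoint from itself.\<close>
      then have "{Inf K<..<Sup K} \<inter> {Inf K<..<Sup K} = {}"
        using disj[of x K x' K'] qp by (auto simp: e_def)
      then show False using A(1) by (auto simp: q_def)
    qed
    have disjP: "disjoint_family_on (\<lambda>(u, v). {u<..<v}) (e ` q)"
      unfolding disjoint_family_on_def
    proof (intro ballI impI)
      fix m n assume "m \<in> e ` q" "n \<in> e ` q" "m \<noteq> n"
      then show "(case m of (u, v) \<Rightarrow> {u<..<v}) \<inter> (case n of (u, v) \<Rightarrow> {u<..<v}) = {}"
        using disj qp by (fastforce simp: e_def)
    qed
    \<comment> \<open>The total length is the measure of a disjoint union contained in
      \<open>U\<close>, hence below \<open>\<delta>\<close>.\<close>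
    have "(\<Sum>(u, v)\<in>e ` q. v - u) = (\<Sum>uv\<in>e ` q. measure lebesgue (case uv of (u, v) \<Rightarrow> {u<..<v}))"
      by (intro sum.cong) (auto simp: e_def q_def)
    also have "\<dots> = measure lebesgue (\<Union>uv\<in>e ` q. case uv of (u, v) \<Rightarrow> {u<..<v})"
      using disjP finq
      by (intro measure_negligible_finite_Union_image[symmetric])
         (auto simp: disjoint_family_on_def pairwise_def)
    also have "\<dots> \<le> measure lebesgue U"
    proof (intro measure_mono_fmeasurable Um)
      show "(\<Union>uv\<in>e ` q. case uv of (u, v) \<Rightarrow> {u<..<v}) \<subseteq> U"
      proof (clarsimp simp: e_def)
        fix x K t assume A: "(x, K) \<in> q" "Inf K < t" "t < Sup K"
        then have "t \<in> {Inf K..Sup K}" by simp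
        then have "t \<in> K" using K[of x K] A(1) qp by blast
        then show "t \<in> U" using K[of x K] A(1) r(2)[of x] by (auto simp: q_def)
      qed
      show "(\<Union>uv\<in>e ` q. case uv of (u, v) \<Rightarrow> {u<..<v}) \<in> sets lebesgue"
        using finq by (intro sets.finite_UN) (auto split: prod.split)
    qed
    also note Ud
    finally have "(\<Sum>(u, v)\<in>e ` q. \<bar>f v - f u\<bar>) < \<epsilon>"
    proof (intro \<delta> disjP)
      show "\<forall>(u, v)\<in>e ` q. a \<le> u \<and> u < v \<and> v \<le> b"
        using K qp by (auto simp: e_def q_def)
    qed (use finq in auto)
    moreover have "(\<Sum>(u, v)\<in>e ` q. \<bar>f v - f u\<bar>) = (\<Sum>(x, K)\<in>q. \<bar>f (Sup K) - f (Inf K)\<bar>)"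
      unfolding sum.reindex[OF inj] by (simp add: e_def case_prod_unfold)
    ultimately have bad: "(\<Sum>(x, K)\<in>q. \<bar>f (Sup K) - f (Inf K)\<bar>) < \<epsilon>" by simp
    have good: "(\<Sum>(x, K)\<in>p - q. \<bar>f (Sup K) - f (Inf K)\<bar>) \<le> (\<Sum>(x, K)\<in>p - q. \<epsilon> * (Sup K - Inf K))"
    proof (intro sum_mono, clarify)
      fix x K assume A: "(x, K) \<in> p" "(x, K) \<notin> q"
      note k = K[OF A(1)]
      show "\<bar>f (Sup K) - f (Inf K)\<bar> \<le> \<epsilon> * (Sup K - Inf K)"
      proof (cases "Inf K = Sup K")
        case True
        then show ?thesis by simp
      next
        case False
        then have "x \<in> {a..b} - N" using A k by (auto simp: q_def)
        moreover have "Inf K \<in> ball x (r x)" "Sup K \<in> ball x (r x)"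
          using k by (metis atLeastAtMost_iff order.trans order_refl subsetD)+
        ultimately have "\<bar>f (Inf K) - f x\<bar> \<le> \<epsilon> * \<bar>Inf K - x\<bar>" "\<bar>f (Sup K) - f x\<bar> \<le> \<epsilon> * \<bar>Sup K - x\<bar>"
          using r(3) by auto
        \<comment> \<open>The tag lies between the endpoints, so the two distances add up to the
          length of \<open>K\<close>.\<close>
        then have "\<bar>f (Inf K) - f x\<bar> \<le> \<epsilon> * (x - Inf K)" "\<bar>f (Sup K) - f x\<bar> \<le> \<epsilon> * (Sup K - x)"
          using k by auto
        then show ?thesis by (simp add: algebra_simps)
      qed
    qed
    have "(\<Sum>(x, K)\<in>p - q. \<epsilon> * (Sup K - Inf K)) \<le> (\<Sum>(x, K)\<in>p. \<epsilon> * (Sup K - Inf K))"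
      using K \<open>\<epsilon> > 0\<close> by (intro sum_mono2 finp) fastforce+
    also have "\<dots> = \<epsilon> * (\<Sum>(x, K)\<in>p. Sup K - Inf K)"
      by (simp add: sum_distrib_left case_prod_unfold)
    also have "(\<Sum>(x, K)\<in>p. Sup K - Inf K) = b - a"
      using additive_tagged_division_1[OF \<open>a \<le> b\<close> p(1), of "\<lambda>x. x"] by simp
    finally have "(\<Sum>(x, K)\<in>p - q. \<bar>f (Sup K) - f (Inf K)\<bar>) \<le> \<epsilon> * (b - a)" using good by linarith
    moreover have "\<bar>f b - f a\<bar> \<le> (\<Sum>(x, K)\<in>p. \<bar>f (Sup K) - f (Inf K)\<bar>)"
      unfolding additive_tagged_division_1[OF \<open>a \<le> b\<close> p(1), of f, symmetric]
      by (simp add: case_prod_unfold)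
    moreover have "(\<Sum>(x, K)\<in>p. \<bar>f (Sup K) - f (Inf K)\<bar>) =
        (\<Sum>(x, K)\<in>p - q. \<bar>f (Sup K) - f (Inf K)\<bar>) + (\<Sum>(x, K)\<in>q. \<bar>f (Sup K) - f (Inf K)\<bar>)"
      by (rule sum.subset_diff[OF qp finp])
    ultimately show ?thesis using bad by linarith
  qed
  have "\<bar>f b - f a\<bar> \<le> 0 + \<eta>" if "\<eta> > 0" for \<eta>
  proof -
    have "\<bar>f b - f a\<bar> \<le> \<eta> / (1 + (b - a)) * (1 + (b - a))"
      using small[of "\<eta> / (1 + (b - a))"] that \<open>a \<le> b\<close> by (simp add: distrib_left)
    then show ?thesis using \<open>a \<le> b\<close> by simp
  qed
  then have "\<bar>f b - f a\<bar> \<le> 0" by (rule field_le_epsilon)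
  then show ?thesis by simp
qed

section \<open>Zeros and sign changes of real functions\<close>

text \<open>The expression extends to a nonconstant entire function, whose zeros cannot accumulate
  in a compact set.\<close>

lemma finite_zeros_linear_plus_sine:
  fixes \<sigma> k d a b :: real
  assumes "\<sigma> \<noteq> 0"
  shows "finite {t \<in> {a..b}. \<sigma> * t + k * sin (2 * pi * t) + d = 0}"
proof -
  define F where "F z = of_real \<sigma> * z + of_real k * sin (2 * of_real pi * z) + of_real d" for z :: complex
  have F: "F (of_real t) = of_real (\<sigma> * t + k * sin (2 * pi * t) + d)" for t
    by (simp add: F_def flip: sin_of_real)
  have "\<not> F constant_on UNIV"
  proof
    assume "F constant_on UNIV"
    \<comment> \<open>The sine vanishes at 0 and at 1, so the two values differ by exactly
      \<sigma>.\<close>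
    then have "F (of_real 1) = F (of_real 0)" by (auto simp: constant_on_def)
    then show False unfolding F of_real_eq_iff using assms by simp
  qed
  moreover have "F holomorphic_on UNIV"
    unfolding F_def by (intro holomorphic_intros)
  ultimately have "finite {z \<in> of_real ` {a..b}. F z = 0}"
    by (intro holomorphic_compact_finite_zeros[of F UNIV])
       (auto intro!: compact_continuous_image continuous_intros)
  then have "finite (complex_of_real -` {z \<in> of_real ` {a..b}. F z = 0})"
    by (rule finite_vimageI) (simp add: inj_of_real)
  then show ?thesis
    by (rule rev_finite_subset) (auto simp: F simp del: of_real_add of_real_mult)
qed

lemma connected_imp_sgn_eq:
  fixes g :: "'a::topological_space \<Rightarrow> real"
  assumes "connected S" "continuous_on S g" "\<And>x. x \<in> S \<Longrightarrow> g x \<noteq> 0" "x \<in> S" "y \<in> S"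
  shows "sgn (g x) = sgn (g y)"
proof -
  have "is_interval (g ` S)"
    using assms by (simp add: connected_continuous_image is_interval_connected_1)
  then have "0 \<in> g ` S" if "g u \<le> 0" "0 \<le> g v" "u \<in> S" "v \<in> S" for u v
    using that mem_is_interval_1_I by blast
  moreover have "0 \<notin> g ` S" using assms(3) by force
  ultimately show ?thesis
    using assms(4,5) by (metis linorder_le_cases linorder_not_less order_le_less sgn_1_neg sgn_1_pos)
qed

lemma sgn_eventually_const_right:
  fixes g :: "real \<Rightarrow> real"
  assumes "p < q" "continuous_on {p..q} g" "finite {x \<in> {p..q}. g x = 0}"
  obtains r \<sigma> where "p < r" "r \<le> q" "\<sigma> = 1 \<or> \<sigma> = -1" "\<And>x. p < x \<Longrightarrow> x < r \<Longrightarrow> sgn (g x) = \<sigma>"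
proof -
  \<comment> \<open>Inserting \<open>q\<close> makes the minimum exist even if there is no zero;
    excluding \<open>p\<close> keeps it to the right of \<open>p\<close>, where \<open>g\<close>
    itself may vanish.\<close>
  define Z where "Z = insert q {x \<in> {p<..q}. g x = 0}"
  have fin: "finite Z" unfolding Z_def
    by (intro finite.insertI finite_subset[OF _ assms(3)]) auto
  define r where "r = Min Z"
  have r: "r \<in> Z" "\<And>x. x \<in> Z \<Longrightarrow> r \<le> x"
    unfolding r_def using Min_in[OF fin] Min_le[OF fin] by (auto simp: Z_def)
  have pr: "p < r" "r \<le> q" using r assms(1) by (auto simp: Z_def)
  have nz: "g x \<noteq> 0" if "p < x" "x < r" for x
    using r(2)[of x] that pr by (auto simp: Z_def)
  have "sgn (g x) = sgn (g ((p + r) / 2))" if "p < x" "x < r" for x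
    by (rule connected_imp_sgn_eq[of "{p<..<r}"])
       (use that nz pr in \<open>auto intro: continuous_on_subset[OF assms(2)]\<close>)
  moreover have "sgn (g ((p + r) / 2)) = 1 \<or> sgn (g ((p + r) / 2)) = -1"
    using nz[of "(p + r) / 2"] pr by (auto simp: sgn_if)
  ultimately show thesis using that pr by metis
qed

lemma sgn_eventually_const_left:
  fixes g :: "real \<Rightarrow> real"
  assumes "p < q" "continuous_on {p..q} g" "finite {x \<in> {p..q}. g x = 0}"
  obtains l \<sigma> where "p \<le> l" "l < q" "\<sigma> = 1 \<or> \<sigma> = -1" "\<And>x. l < x \<Longrightarrow> x < q \<Longrightarrow> sgn (g x) = \<sigma>"
proof -
  \<comment> \<open>The reflection \<open>x \<mapsto> - x\<close> reduces this case to the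
    right-hand one.\<close>
  have "{x \<in> {-q..-p}. g (- x) = 0} \<subseteq> uminus ` {x \<in> {p..q}. g x = 0}"
  proof
    fix x assume "x \<in> {x \<in> {-q..-p}. g (- x) = 0}"
    then show "x \<in> uminus ` {x \<in> {p..q}. g x = 0}" by (intro image_eqI[of _ _ "- x"]) auto
  qed
  then have "finite {x \<in> {-q..-p}. g (- x) = 0}" by (rule finite_surj[OF assms(3)])
  moreover have "continuous_on {-q..-p} (\<lambda>x. g (- x))"
    by (rule continuous_on_compose2[OF assms(2)]) (auto intro!: continuous_intros)
  ultimately obtain r \<sigma> where r: "-q < r" "r \<le> -p" "\<sigma> = 1 \<or> \<sigma> = -1"
    "\<And>x. -q < x \<Longrightarrow> x < r \<Longrightarrow> sgn (g (- x)) = \<sigma>"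
    using sgn_eventually_const_right[of "-q" "-p" "\<lambda>x. g (- x)"] assms(1) by auto
  show thesis
  proof (rule that)
    show "p \<le> - r" "- r < q" "\<sigma> = 1 \<or> \<sigma> = -1" using r by auto
    show "sgn (g x) = \<sigma>" if "- r < x" "x < q" for x using r(4)[of "- x"] that by simp
  qed
qed

lemma crosses_zero_at_uminus: "crosses_zero_at (\<lambda>t. - h t) z \<longleftrightarrow> crosses_zero_at h z"
  by (simp add: crosses_zero_at_def)

section \<open>Solutions of the integral equation\<close>

lemma abs_relay_rhs_le:
  fixes h :: "real \<Rightarrow> real"
  shows "\<bar>- sgn (h (s - \<tau>)) + c * cos (2 * pi * s)\<bar> \<le> 1 + \<bar>c\<bar>"
proof -
  have "\<bar>c * cos (2 * pi * s)\<bar> \<le> \<bar>c\<bar>" by (simp add: abs_mult mult_left_le)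
  moreover have "\<bar>sgn (h (s - \<tau>))\<bar> \<le> 1" by (simp add: sgn_if)
  ultimately show ?thesis by linarith
qed

text \<open>The sign of \<open>c\<close> is left free so that the locale is closed under
  \<open>(c, h) \<mapsto> (- c, - h)\<close>; one-sided statements then come in pairs.\<close>

locale relay_equation =
  fixes c \<tau> t0 :: real and h :: "real \<Rightarrow> real"
  assumes tau_pos: "\<tau> > 0"
    and cont: "continuous_on {t0 - \<tau>..} h"
    and finite_initial_zeros: "finite {t \<in> {t0 - \<tau>..t0}. h t = 0}"
    and integral_eq: "\<And>u v. t0 \<le> u \<Longrightarrow> u \<le> v \<Longrightarrow>
      ((\<lambda>s. - sgn (h (s - \<tau>)) + c * cos (2 * pi * s)) has_integral (h v - h u)) {u..v}"
begin

lemma relay_equation_uminus: "relay_equation (- c) \<tau> t0 (\<lambda>t. - h t)"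
proof
  show "((\<lambda>s. - sgn (- h (s - \<tau>)) + - c * cos (2 * pi * s)) has_integral (- h v - - h u)) {u..v}"
    if "t0 \<le> u" "u \<le> v" for u v
    using has_integral_neg[OF integral_eq[OF that]] by (simp add: sgn_minus)
qed (use tau_pos cont finite_initial_zeros in \<open>auto intro: continuous_intros\<close>)

section \<open>The solution without its periodic part\<close>

text \<open>The factor for which \<open>amp * sin (2 * pi * t)\<close> is an antiderivative of the
  forcing term.\<close>

definition amp :: real where "amp = c / (2 * pi)"

definition unforced :: "real \<Rightarrow> real" where
  "unforced t = h t - amp * sin (2 * pi * t)"

lemma h_eq: "h t = unforced t + amp * sin (2 * pi * t)"
  by (simp add: unforced_def)

lemma abs_h_minus_unforced: "\<bar>h t - unforced t\<bar> \<le> \<bar>amp\<bar>"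
  by (simp add: unforced_def abs_mult mult_left_le)

lemma unforced_has_integral:
  assumes "t0 \<le> u" "u \<le> v"
  shows "((\<lambda>s. - sgn (h (s - \<tau>))) has_integral (unforced v - unforced u)) {u..v}"
proof -
  have "((\<lambda>s. c * cos (2 * pi * s)) has_integral (amp * sin (2 * pi * v) - amp * sin (2 * pi * u))) {u..v}"
    using assms(2)
    by (intro fundamental_theorem_of_calculus)
       (auto simp: amp_def has_real_derivative_iff_has_vector_derivative[symmetric]
             intro!: derivative_eq_intros)
  from has_integral_diff[OF integral_eq[OF assms] this]
  show ?thesis by (simp add: unforced_def algebra_simps)
qed

text \<open>The integrand is constant off a finite set, which does not affect the integral. Allowing
  \<open>S\<close> lets the delayed function have isolated zeros.\<close>

lemma unforced_increment:
  assumes "t0 \<le> u" "u \<le> v" "finite S"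
    and "\<And>s. s \<in> {u<..<v} - S \<Longrightarrow> sgn (h (s - \<tau>)) = \<sigma>"
  shows "unforced v - unforced u = - \<sigma> * (v - u)"
proof -
  have "((\<lambda>s. - \<sigma>) has_integral (unforced v - unforced u)) {u..v}"
    by (rule has_integral_spike_finite[OF _ _ unforced_has_integral[OF assms(1,2)], of "insert u (insert v S)"])
       (use assms in auto)
  moreover have "((\<lambda>s. - \<sigma>) has_integral (- \<sigma> * (v - u))) {u..v}"
    using has_integral_const_real[of "- \<sigma>" u v] assms(2) by (simp add: mult.commute)
  ultimately show ?thesis by (rule has_integral_unique)
qed

lemma unforced_lipschitz:
  assumes "t0 \<le> u" "u \<le> v"
  shows "\<bar>unforced v - unforced u\<bar> \<le> v - u"
  using has_integral_bound_real[of 1 "{}", OF _ _ unforced_has_integral[OF assms]] assms(2)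
  by (simp add: sgn_if)

lemma lipschitz:
  assumes "t0 \<le> u" "u \<le> v"
  shows "\<bar>h v - h u\<bar> \<le> (1 + \<bar>c\<bar>) * (v - u)"
  using has_integral_bound_real[of "1 + \<bar>c\<bar>" "{}", OF _ _ integral_eq[OF assms]]
    abs_relay_rhs_le assms(2) by simp

section \<open>Finiteness of zeros on bounded intervals\<close>

lemma finite_zeros_of_const_sign:
  assumes "t0 \<le> u" "\<sigma> \<noteq> 0" and sg: "\<And>s. u < s \<Longrightarrow> s < v \<Longrightarrow> sgn (h (s - \<tau>)) = \<sigma>"
  shows "finite {t \<in> {u..v}. h t = 0}"
proof (rule finite_subset[OF _ finite_zeros_linear_plus_sine])
  show "{t \<in> {u..v}. h t = 0} \<subseteq>
    {t \<in> {u..v}. (- \<sigma>) * t + amp * sin (2 * pi * t) + (unforced u + \<sigma> * u) = 0}"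
  proof clarsimp
    fix t assume t: "u \<le> t" "t \<le> v" "h t = 0"
    then have "unforced t - unforced u = - \<sigma> * (t - u)"
      using assms(1) sg by (intro unforced_increment[where S = "{}"]) auto
    then show "amp * sin (2 * pi * t) - \<sigma> * t + (unforced u + \<sigma> * u) = 0"
      using t(3) h_eq[of t] by (simp add: algebra_simps)
  qed
qed (use assms in simp)

text \<open>Finitely many delayed zeros leave the delayed sign constant on a short interval on each
  side of any point. There \<open>finite_zeros_of_const_sign\<close> applies, and bisection glues
  these local statements over the compact interval.\<close>

lemma finite_zeros_step:
  assumes "t0 \<le> T" "finite {t \<in> {t0 - \<tau>..T - \<tau>}. h t = 0}"
  shows "finite {t \<in> {t0..T}. h t = 0}"
proof -
  have "{t \<in> {t0..T}. h (t - \<tau>) = 0} \<subseteq> (\<lambda>t. t + \<tau>) ` {t \<in> {t0 - \<tau>..T - \<tau>}. h t = 0}"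
  proof
    fix t assume "t \<in> {t \<in> {t0..T}. h (t - \<tau>) = 0}"
    then show "t \<in> (\<lambda>t. t + \<tau>) ` {t \<in> {t0 - \<tau>..T - \<tau>}. h t = 0}"
      by (intro image_eqI[of _ _ "t - \<tau>"]) auto
  qed
  then have fin: "finite {t \<in> {t0..T}. h (t - \<tau>) = 0}" by (rule finite_surj[OF assms(2)])
  have contd: "continuous_on {u..v} (\<lambda>t. h (t - \<tau>))" if "t0 \<le> u" for u v
    by (rule continuous_on_compose2[OF cont]) (use that in \<open>auto intro!: continuous_intros\<close>)
  have right: "\<exists>r>x. finite {t \<in> {x..r} \<inter> {t0..T}. h t = 0}" if x: "t0 \<le> x" "x \<le> T" for x
  proof (cases "x = T")
    case True
    then have "{t \<in> {x..x+1} \<inter> {t0..T}. h t = 0} \<subseteq> {T}" by auto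
    then show ?thesis by (intro exI[of _ "x+1"]) (auto intro: finite_subset)
  next
    case False
    then have "x < T" using x by simp
    have "finite {t \<in> {x..T}. h (t - \<tau>) = 0}" by (rule finite_subset[OF _ fin]) (use x in auto)
    from sgn_eventually_const_right[OF \<open>x < T\<close> contd[OF x(1)] this]
    obtain r \<sigma> where r: "x < r" "\<sigma> = 1 \<or> \<sigma> = -1"
      "\<And>s. x < s \<Longrightarrow> s < r \<Longrightarrow> sgn (h (s - \<tau>)) = \<sigma>"
      by metis
    then have "finite {t \<in> {x..r}. h t = 0}"
      using x by (intro finite_zeros_of_const_sign[of x \<sigma>]) auto
    then show ?thesis using r(1) by (intro exI[of _ r]) (auto elim: rev_finite_subset)
  qed
  have left: "\<exists>l<x. finite {t \<in> {l..x} \<inter> {t0..T}. h t = 0}" if x: "t0 \<le> x" "x \<le> T" for x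
  proof (cases "x = t0")
    case True
    then have "{t \<in> {x-1..x} \<inter> {t0..T}. h t = 0} \<subseteq> {t0}" by auto
    then show ?thesis by (intro exI[of _ "x-1"]) (auto intro: finite_subset)
  next
    case False
    then have "t0 < x" using x by simp
    have "finite {t \<in> {t0..x}. h (t - \<tau>) = 0}" by (rule finite_subset[OF _ fin]) (use x in auto)
    from sgn_eventually_const_left[OF \<open>t0 < x\<close> contd[OF order_refl] this]
    obtain l \<sigma> where l: "t0 \<le> l" "l < x" "\<sigma> = 1 \<or> \<sigma> = -1"
      "\<And>s. l < s \<Longrightarrow> s < x \<Longrightarrow> sgn (h (s - \<tau>)) = \<sigma>"
      by metis
    then have "finite {t \<in> {l..x}. h t = 0}"
      by (intro finite_zeros_of_const_sign[of l \<sigma>]) auto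
    then show ?thesis using l(2) by (intro exI[of _ l]) (auto elim: rev_finite_subset)
  qed
  \<comment> \<open>Bolzano's principle also tests intervals that stick out of
    \<open>{t0..T}\<close>; intersecting with it leaves only zeros that are under control.\<close>
  define P where "P u v \<longleftrightarrow> finite {t \<in> {u..v} \<inter> {t0..T}. h t = 0}" for u v
  have "P t0 T"
  proof (rule Bolzano[OF assms(1), of P])
    fix a b c assume *: "P a b" "P b c" "a \<le> b" "b \<le> c"
    show "P a c"
      unfolding P_def by (rule finite_subset[OF _ finite_UnI[OF *(1,2)[unfolded P_def]]]) auto
  next
    fix x assume x: "t0 \<le> x" "x \<le> T"
    obtain r where r: "r > x" "P x r" using right[OF x] by (auto simp: P_def)
    obtain l where l: "l < x" "P l x" using left[OF x] by (auto simp: P_def)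
    show "\<exists>d>0. \<forall>a b. a \<le> x \<and> x \<le> b \<and> b - a < d \<longrightarrow> P a b"
    proof (intro exI[of _ "min (r - x) (x - l)"] conjI allI impI)
      fix a b assume "a \<le> x \<and> x \<le> b \<and> b - a < min (r - x) (x - l)"
      then show "P a b"
        unfolding P_def
        by (intro finite_subset[OF _ finite_UnI[OF l(2)[unfolded P_def] r(2)[unfolded P_def]]]) auto
    qed (use l r in auto)
  qed
  then show ?thesis by (simp add: P_def)
qed

lemma finite_zeros: "finite {t \<in> {t0 - \<tau>..T}. h t = 0}"
proof -
  have *: "finite {t \<in> {t0 - \<tau>..t0 + real n * \<tau>}. h t = 0}" for n
  proof (induction n)
    case 0
    then show ?case using finite_initial_zeros by simp
  next
    case (Suc n)
    have "finite {t \<in> {t0..t0 + real (Suc n) * \<tau>}. h t = 0}"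
      using Suc tau_pos by (intro finite_zeros_step) (auto simp: algebra_simps)
    from finite_UnI[OF Suc this] show ?case
      by (rule rev_finite_subset) (use tau_pos in \<open>auto intro: order_trans[of _ t0]\<close>)
  qed
  obtain n where "T - t0 < real n * \<tau>" using reals_Archimedean3[OF tau_pos] by blast
  then show ?thesis by (intro finite_subset[OF _ *[of n]]) auto
qed

lemma sgn_const_right:
  assumes "t0 - \<tau> \<le> p"
  obtains r \<sigma> where "p < r" "\<sigma> = 1 \<or> \<sigma> = -1" "\<And>x. p < x \<Longrightarrow> x < r \<Longrightarrow> sgn (h x) = \<sigma>"
  by (rule sgn_eventually_const_right[of p "p + 1" h])
     (use assms in \<open>auto intro: continuous_on_subset[OF cont] finite_subset[OF _ finite_zeros[of "p + 1"]]\<close>)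

lemma sgn_const_left:
  assumes "t0 - \<tau> < p"
  obtains l \<sigma> where "t0 - \<tau> \<le> l" "l < p" "\<sigma> = 1 \<or> \<sigma> = -1" "\<And>x. l < x \<Longrightarrow> x < p \<Longrightarrow> sgn (h x) = \<sigma>"
  by (rule sgn_eventually_const_left[of "t0 - \<tau>" p h])
     (use assms finite_zeros[of p] in \<open>auto intro: continuous_on_subset[OF cont]\<close>)

section \<open>Recovering the differential equation\<close>

text \<open>By continuity the delayed sign is constant near \<open>t\<close>, so \<open>h\<close>
  coincides there with an explicit smooth formula.\<close>

lemma has_derivative_off_zeros:
  assumes "t0 < t" "h (t - \<tau>) \<noteq> 0"
  shows "(h has_real_derivative (- sgn (h (t - \<tau>)) + c * cos (2 * pi * t))) (at t)"
proof -
  let ?p = "t - \<tau>"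
  have "isCont h ?p"
    using continuous_on_interior[OF cont] assms(1) by simp
  then obtain e0 where e0: "e0 > 0" "\<And>s. dist ?p s < e0 \<Longrightarrow> h s \<noteq> 0"
    using continuous_at_avoid[of ?p h 0] assms(2) by metis
  \<comment> \<open>The cap \<open>t - t0\<close> keeps the window to the right of
    \<open>t0\<close>, where the integral equation holds.\<close>
  define e where "e = min e0 (t - t0)"
  have e: "e > 0" "e \<le> e0" "e \<le> t - t0" using e0(1) assms(1) by (simp_all add: e_def)
  have sg: "sgn (h (s - \<tau>)) = sgn (h ?p)" if "t - e < s" "s < t + e" for s
    by (rule connected_imp_sgn_eq[of "{?p - e<..<?p + e}"])
       (use that e e0(2) in \<open>auto intro: continuous_on_subset[OF cont] simp: dist_real_def\<close>)
  \<comment> \<open>The base point lies strictly left of \<open>t\<close>, so the formula holds on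
    an open neighbourhood of \<open>t\<close>.\<close>
  define a where "a = t - e / 2"
  have *: "h x = - sgn (h ?p) * (x - a) + unforced a + amp * sin (2 * pi * x)" if x: "x \<in> {a<..<t + e}" for x
  proof -
    have "unforced x - unforced a = - sgn (h ?p) * (x - a)"
    proof (rule unforced_increment)
      show "sgn (h (s - \<tau>)) = sgn (h ?p)" if "s \<in> {a<..<x} - {}" for s
        by (rule sg) (use that x e in \<open>auto simp: a_def\<close>)
    qed (use x e in \<open>auto simp: a_def\<close>)
    then show ?thesis by (simp add: h_eq)
  qed
  have "((\<lambda>x. - sgn (h ?p) * (x - a) + unforced a + amp * sin (2 * pi * x)) has_real_derivative
      (- sgn (h ?p) + c * cos (2 * pi * t))) (at t)"
    by (auto simp: amp_def intro!: derivative_eq_intros)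
  then show ?thesis
    by (rule has_field_derivative_transform_within_open[of _ _ _ "{a<..<t + e}"])
       (use * e in \<open>auto simp: a_def\<close>)
qed

section \<open>Boundedness\<close>

text \<open>Above the level \<open>\<bar>amp\<bar> + \<tau>\<close> the unforced part was above \<open>\<bar>amp\<bar>\<close> one delay earlier, so \<open>h\<close> was
  positive there and the unforced part decreases.\<close>

lemma upper_bound: "\<exists>B. \<forall>t\<ge>t0. h t \<le> B"
proof -
  \<comment> \<open>The first term covers the initial delay interval, over which the unforced part
    rises by at most \<tau>.\<close>
  define M where "M = max (unforced t0 + \<tau>) (\<bar>amp\<bar> + \<tau>)"
  have "unforced t1 \<le> M" if "t0 \<le> t1" for t1
  proof (rule ccontr)
    assume gt: "\<not> unforced t1 \<le> M"
    have early: "unforced x \<le> M" if "t0 \<le> x" "x \<le> t0 + \<tau>" for x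
      using unforced_lipschitz[of t0 x] that by (simp add: M_def)
    \<comment> \<open>The largest element \<open>s\<close> of \<open>X\<close> is the last time
      before \<open>t1\<close> at which the level \<open>M\<close> is respected. From then on the
      slope is -1, so the level cannot be exceeded at \<open>t1\<close>.\<close>
    define X where "X = {x \<in> {t0 + \<tau>..t1}. unforced x \<le> M}"
    have t1: "t0 + \<tau> < t1" using gt early \<open>t0 \<le> t1\<close> by force
    have "continuous_on {t0 + \<tau>..t1} unforced"
      unfolding unforced_def by (intro continuous_intros continuous_on_subset[OF cont]) (use tau_pos in auto)
    then have "closed X" unfolding X_def by (intro continuous_on_closed_Collect_le) auto
    moreover have "bounded X" by (rule bounded_subset[of "{t0 + \<tau>..t1}"]) (auto simp: X_def)
    moreover have "t0 + \<tau> \<in> X" using early[of "t0 + \<tau>"] t1 tau_pos by (simp add: X_def)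
    ultimately obtain s where s: "s \<in> X" "\<And>x. x \<in> X \<Longrightarrow> x \<le> s"
      using compact_attains_sup[of X] by (auto simp: compact_eq_bounded_closed)
    have above: "unforced x > M" if "s < x" "x \<le> t1" for x
      using s(2)[of x] s(1) that by (force simp: X_def)
    have "s \<le> t1" "t0 \<le> s" "unforced s \<le> M" using s(1) tau_pos by (auto simp: X_def)
    have "sgn (h (x - \<tau>)) = 1" if "x \<in> {s<..<t1}" for x
    proof -
      have "t0 \<le> x - \<tau>" using that s(1) by (auto simp: X_def)
      then have "\<bar>unforced x - unforced (x - \<tau>)\<bar> \<le> \<tau>"
        using unforced_lipschitz[of "x - \<tau>" x] tau_pos by simp
      then have "unforced (x - \<tau>) > \<bar>amp\<bar>" using above[of x] that by (auto simp: M_def)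
      then show ?thesis using abs_h_minus_unforced[of "x - \<tau>"] by (simp add: sgn_1_pos)
    qed
    then have "unforced t1 - unforced s = - 1 * (t1 - s)"
      using \<open>t0 \<le> s\<close> \<open>s \<le> t1\<close> by (intro unforced_increment[where S = "{}"]) auto
    then show False using gt \<open>unforced s \<le> M\<close> \<open>s \<le> t1\<close> by simp
  qed
  then have "h t \<le> M + \<bar>amp\<bar>" if "t \<ge> t0" for t
    using that abs_h_minus_unforced[of t] by force
  then show ?thesis by blast
qed

lemma bounded_solution: "bounded (h ` {t0..})"
proof -
  interpret neg: relay_equation "- c" \<tau> t0 "\<lambda>t. - h t" by (rule relay_equation_uminus)
  obtain B where B: "\<And>t. t \<ge> t0 \<Longrightarrow> h t \<le> B" using upper_bound by blast
  obtain B' where B': "\<And>t. t \<ge> t0 \<Longrightarrow> - h t \<le> B'" using neg.upper_bound by blast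
  show ?thesis
    by (rule boundedI[of _ "max B B'"]) (use B B' in \<open>force simp: abs_le_iff\<close>)
qed

section \<open>Sign changes\<close>

text \<open>If \<open>h\<close> stayed nonnegative after \<open>s\<close>, then from
  \<open>s + \<tau>\<close> on the delayed sign would be 1 apart from isolated zeros, and the
  unforced part would decrease without bound.\<close>

lemma becomes_negative:
  assumes "t0 \<le> s"
  shows "\<exists>t>s. h t < 0"
proof (rule ccontr)
  assume "\<not> (\<exists>t>s. h t < 0)"
  then have nonneg: "h t \<ge> 0" if "t > s" for t using that by (meson linorder_not_le)
  define u where "u = s + \<tau>"
  \<comment> \<open>This length lets slope -1 bring \<open>unforced\<close> down to at most
    \<open>- \<bar>amp\<bar> - 1\<close>, which forces \<open>h v \<le> -1\<close>.\<close>
  define v where "v = u + \<bar>unforced u\<bar> + \<bar>amp\<bar> + 1"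
  let ?S = "{t \<in> {u..v}. h (t - \<tau>) = 0}"
  have uv: "t0 \<le> u" "u \<le> v" using assms tau_pos by (auto simp: u_def v_def)
  have "?S \<subseteq> (\<lambda>t. t + \<tau>) ` {t \<in> {t0 - \<tau>..v - \<tau>}. h t = 0}"
  proof
    fix t assume "t \<in> ?S"
    then show "t \<in> (\<lambda>t. t + \<tau>) ` {t \<in> {t0 - \<tau>..v - \<tau>}. h t = 0}"
      using uv by (intro image_eqI[of _ _ "t - \<tau>"]) auto
  qed
  then have "finite ?S" by (rule finite_surj[OF finite_zeros])
  moreover have "sgn (h (t - \<tau>)) = 1" if "t \<in> {u<..<v} - ?S" for t
    using nonneg[of "t - \<tau>"] that by (force simp: u_def sgn_1_pos)
  ultimately have "unforced v - unforced u = - 1 * (v - u)"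
    using uv by (intro unforced_increment)
  then have "unforced v = unforced u - (v - u)" by simp
  moreover have "h v \<ge> 0" using nonneg[of v] tau_pos by (simp add: u_def v_def)
  moreover have "h v - unforced v \<le> \<bar>amp\<bar>" using abs_h_minus_unforced[of v] by simp
  moreover have "v - u = \<bar>unforced u\<bar> + \<bar>amp\<bar> + 1" by (simp add: v_def)
  ultimately show False using abs_ge_self[of "unforced u"] by linarith
qed

text \<open>The crossing is the infimum \<open>z\<close> of the negative points up to some
  \<open>t1\<close> after \<open>s\<close>. Since zeros are locally finite, \<open>h\<close> has a
  constant nonzero sign just before and just after \<open>z\<close>, which excludes touching zero
  along an interval.\<close>

lemma crosses_after_positive:
  assumes "t0 \<le> s" "h s > 0"
  shows "\<exists>z>s. crosses_zero_at h z"
proof -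
  obtain t1 where t1: "t1 > s" "h t1 < 0" using becomes_negative[OF assms(1)] by blast
  define X where "X = {x \<in> {s..t1}. h x < 0}"
  define z where "z = Inf X"
  have X: "t1 \<in> X" "bdd_below X" using t1 by (auto simp: X_def)
  have cst: "continuous_on {s..t1} h"
    using assms(1) tau_pos by (auto intro: continuous_on_subset[OF cont])
  have "z \<in> closure X" unfolding z_def by (rule closure_contains_Inf) (use X in auto)
  moreover have "closed {x \<in> {s..t1}. h x \<le> 0}"
    by (intro continuous_on_closed_Collect_le cst) auto
  moreover have "X \<subseteq> {x \<in> {s..t1}. h x \<le> 0}" by (auto simp: X_def)
  ultimately have z: "z \<in> {s..t1}" "h z \<le> 0" using closure_minimal by blast+
  then have "s < z" using assms(2) by (cases "z = s") auto
  have before: "h x \<ge> 0" if "s \<le> x" "x < z" for x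
    using cInf_lower[of x X] X that z by (force simp: X_def z_def)
  have "closed {x \<in> {s..t1}. 0 \<le> h x}"
    by (intro continuous_on_closed_Collect_le cst) auto
  moreover have "z \<in> closure {s..<z}" using \<open>s < z\<close> by simp
  moreover have "{s..<z} \<subseteq> {x \<in> {s..t1}. 0 \<le> h x}" using before z(1) by auto
  ultimately have "h z \<ge> 0" using closure_minimal by blast
  then have hz: "h z = 0" using z by simp
  have zt: "t0 - \<tau> < z" using \<open>s < z\<close> assms(1) tau_pos by simp
  obtain r \<sigma> where r: "z < r" "\<And>x. z < x \<Longrightarrow> x < r \<Longrightarrow> sgn (h x) = \<sigma>"
    using sgn_const_right[of z] zt by (metis less_imp_le)
  obtain l \<rho> where l: "l < z" "\<rho> = 1 \<or> \<rho> = -1" "\<And>x. l < x \<Longrightarrow> x < z \<Longrightarrow> sgn (h x) = \<rho>"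
    using sgn_const_left[OF zt] by metis
  \<comment> \<open>Negative points occur arbitrarily close to the infimum, and \<open>z\<close> is
    not one of them; so the sign just after \<open>z\<close> is -1.\<close>
  obtain x where "x \<in> X" "x < r" using cInf_lessD[of X r] X r(1) by (auto simp: z_def)
  moreover have "z \<le> x" using cInf_lower \<open>x \<in> X\<close> X(2) by (auto simp: z_def)
  ultimately have "\<sigma> = -1" using r(2)[of x] hz by (cases "x = z") (auto simp: X_def)
  obtain y where y: "max l s < y" "y < z" using dense[of "max l s" z] l \<open>s < z\<close> by auto
  then have "\<rho> = 1" using before[of y] l(2) l(3)[of y] by (auto simp: sgn_1_neg)
  have "crosses_zero_at h z" unfolding crosses_zero_at_def
  proof (intro conjI exI[of _ "min (r - z) (z - l)"] ballI)
    fix x y assume "x \<in> {z - min (r - z) (z - l)<..<z}" "y \<in> {z<..<z + min (r - z) (z - l)}"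
    then have "sgn (h x) = 1" "sgn (h y) = -1"
      using r(2)[of y] l(3)[of x] \<open>\<sigma> = -1\<close> \<open>\<rho> = 1\<close> by auto
    then show "h x * h y < 0" by (simp add: sgn_1_pos sgn_1_neg mult_pos_neg)
  qed (use hz r l in auto)
  then show ?thesis using \<open>s < z\<close> by blast
qed

text \<open>Beyond any bound on the crossings \<open>h\<close> still takes a nonzero value, and
  \<open>crosses_after_positive\<close>, applied to \<open>h\<close> or to \<open>- h\<close>,
  yields a later crossing.\<close>

lemma infinitely_many_crossings: "infinite {z. z > t0 \<and> crosses_zero_at h z}"
proof
  interpret neg: relay_equation "- c" \<tau> t0 "\<lambda>t. - h t" by (rule relay_equation_uminus)
  let ?Z = "{z. z > t0 \<and> crosses_zero_at h z}"
  assume "finite ?Z"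
  then have "bdd_above ?Z" by simp
  then obtain T where T: "\<And>z. z \<in> ?Z \<Longrightarrow> z \<le> T" by (auto simp: bdd_above_def)
  define a where "a = max T t0"
  have "\<exists>s>a. h s \<noteq> 0"
    using becomes_negative[of a] by (force simp: a_def)
  then obtain s where s: "s > a" "h s \<noteq> 0" by blast
  obtain z where "z > s" "crosses_zero_at h z"
    using crosses_after_positive[of s] neg.crosses_after_positive[of s] s
    by (cases "h s > 0") (auto simp: a_def crosses_zero_at_uminus)
  then show False using T[of z] s(1) by (simp add: a_def)
qed

end

section \<open>Existence and uniqueness\<close>

text \<open>The integrand is bounded and measurable. Continuity is demanded only one delay earlier,
  which is what an induction over delay intervals can supply.\<close>

lemma relay_integrable:
  fixes h :: "real \<Rightarrow> real"
  assumes "continuous_on {a - \<tau>..b - \<tau>} h"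
  shows "(\<lambda>s. - sgn (h (s - \<tau>)) + c * cos (2 * pi * s)) integrable_on {a..b}"
proof (rule measurable_bounded_by_integrable_imp_integrable_real)
  have "continuous_on {a..b} (\<lambda>s. h (s - \<tau>))"
    by (rule continuous_on_compose2[OF assms]) (auto intro!: continuous_intros)
  then have [measurable]: "(\<lambda>s. h (s - \<tau>)) \<in> borel_measurable (lebesgue_on {a..b})"
    by (rule continuous_imp_measurable_on_sets_lebesgue) auto
  have [measurable]: "(\<lambda>s. c * cos (2 * pi * s)) \<in> borel_measurable (lebesgue_on {a..b})"
    by (rule continuous_imp_measurable_on_sets_lebesgue) (auto intro!: continuous_intros)
  show "(\<lambda>s. - sgn (h (s - \<tau>)) + c * cos (2 * pi * s)) \<in> borel_measurable (lebesgue_on {a..b})"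
    by measurable
  show "(\<lambda>s. 1 + \<bar>c\<bar>) integrable_on {a..b}" by (rule integrable_const_ivl)
  show "\<bar>- sgn (h (s - \<tau>)) + c * cos (2 * pi * s)\<bar> \<le> 1 + \<bar>c\<bar>" for s
    by (rule abs_relay_rhs_le)
qed simp

text \<open>With this congruence rule the integral equation itself is an admissible recursive definition:
  the integrand at \<open>s \<in> {t0..t}\<close> only needs the values at \<open>s - \<tau>\<close>.\<close>

lemma integral_fundef_cong [fundef_cong]:
  "S = T \<Longrightarrow> (\<And>x. x \<in> T \<Longrightarrow> f x = g x) \<Longrightarrow> integral S f = integral T g"
  using integral_cong by blast

function delay_solution :: "real \<Rightarrow> real \<Rightarrow> real \<Rightarrow> (real \<Rightarrow> real) \<Rightarrow> real \<Rightarrow> real" where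
  "delay_solution c \<tau> t0 \<phi> t =
    (if t \<le> t0 \<or> \<tau> \<le> 0 then \<phi> (t - t0)
     else \<phi> 0 + integral {t0..t} (\<lambda>s. - sgn (delay_solution c \<tau> t0 \<phi> (s - \<tau>)) + c * cos (2 * pi * s)))"
  by auto
termination
\<comment> \<open>The measure counts the delay intervals begun since \<open>t0\<close>; going back
  by \<tau> lowers it by at least one. For \<open>\<tau> \<le> 0\<close> the defining equation falls
  back on a default value without recursion.\<close>
proof (relation "Wellfounded.measure (\<lambda>(c, \<tau>, t0, \<phi>, t). nat \<lceil>(t - t0) / \<tau>\<rceil>)", simp, clarsimp)
  fix \<tau> t0 t x :: real
  assume A: "\<not> t \<le> t0" "\<not> \<tau> \<le> 0" "t0 \<le> x" "x \<le> t"
  then have "(x - \<tau> - t0) / \<tau> \<le> (t - t0) / \<tau> - 1" by (simp add: field_simps)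
  then have "\<lceil>(x - \<tau> - t0) / \<tau>\<rceil> \<le> \<lceil>(t - t0) / \<tau>\<rceil> - 1" by linarith
  then show "\<lceil>(x - \<tau> - t0) / \<tau>\<rceil> < \<lceil>(t - t0) / \<tau>\<rceil>" by linarith
qed

declare delay_solution.simps [simp del]

lemma delay_solution_initial: "t \<le> t0 \<Longrightarrow> delay_solution c \<tau> t0 \<phi> t = \<phi> (t - t0)"
  by (simp add: delay_solution.simps)

text \<open>At \<open>t = t0\<close> the recursion takes its initial branch, which agrees with the
  formula because the integral over a single point is zero.\<close>

lemma delay_solution_eq:
  assumes "\<tau> > 0" "t0 \<le> t"
  shows "delay_solution c \<tau> t0 \<phi> t = \<phi> 0 +
    integral {t0..t} (\<lambda>s. - sgn (delay_solution c \<tau> t0 \<phi> (s - \<tau>)) + c * cos (2 * pi * s))"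
proof (cases "t = t0")
  case True
  then show ?thesis by (simp add: delay_solution_initial)
next
  case False
  then show ?thesis using assms by (subst delay_solution.simps) simp
qed

text \<open>Continuity up to \<open>t0 + real n * \<tau>\<close> makes the integrand integrable one
  delay further, and an indefinite integral is continuous.\<close>

lemma continuous_on_delay_solution:
  assumes "\<tau> > 0" "continuous_on {- \<tau>..0} \<phi>"
  shows "continuous_on {t0 - \<tau>..} (delay_solution c \<tau> t0 \<phi>)"
proof -
  let ?h = "delay_solution c \<tau> t0 \<phi>"
  have init: "continuous_on {t0 - \<tau>..t0} ?h"
  proof (rule continuous_on_eq)
    show "continuous_on {t0 - \<tau>..t0} (\<lambda>t. \<phi> (t - t0))"
      by (rule continuous_on_compose2[OF assms(2)]) (auto intro!: continuous_intros)
  qed (simp add: delay_solution_initial)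
  have *: "continuous_on {t0 - \<tau>..t0 + real n * \<tau>} ?h" for n
  proof (induction n)
    case 0
    then show ?case using init by simp
  next
    case (Suc n)
    let ?T = "t0 + real (Suc n) * \<tau>"
    have "continuous_on {t0 - \<tau>..?T - \<tau>} ?h" using Suc by (simp add: algebra_simps)
    then have "continuous_on {t0..?T} (\<lambda>t. \<phi> 0 +
        integral {t0..t} (\<lambda>s. - sgn (?h (s - \<tau>)) + c * cos (2 * pi * s)))"
      by (intro continuous_intros indefinite_integral_continuous_1 relay_integrable)
    then have "continuous_on {t0..?T} ?h"
      by (rule continuous_on_eq) (use assms(1) delay_solution_eq in auto)
    with init have "continuous_on ({t0 - \<tau>..t0} \<union> {t0..?T}) ?h"
      by (intro continuous_on_closed_Un) auto
    moreover have "{t0 - \<tau>..t0} \<union> {t0..?T} = {t0 - \<tau>..?T}"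
      using assms(1) by (intro ivl_disj_un) auto
    ultimately show ?case by simp
  qed
  show ?thesis
    unfolding continuous_on_eq_continuous_within
  proof
    fix t assume t: "t \<in> {t0 - \<tau>..}"
    obtain n where n: "t - t0 < real n * \<tau>" using reals_Archimedean3[OF assms(1)] by blast
    \<comment> \<open>Continuity is local, and \<open>t\<close> lies strictly below the right end of
      the bounded interval, so both filters agree.\<close>
    have "at t within {t0 - \<tau>..} = at t within {t0 - \<tau>..t0 + real n * \<tau>}"
      by (rule at_within_nhd[of _ "{..<t0 + real n * \<tau>}"]) (use n in auto)
    then show "continuous (at t within {t0 - \<tau>..}) ?h"
      using *[of n] t n by (simp add: continuous_on_eq_continuous_within)
  qed
qed

lemma relay_equation_delay_solution:
  assumes "\<tau> > 0" "continuous_on {- \<tau>..0} \<phi>" "finite {s \<in> {- \<tau>..0}. \<phi> s = 0}"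
  shows "relay_equation c \<tau> t0 (delay_solution c \<tau> t0 \<phi>)"
proof
  let ?h = "delay_solution c \<tau> t0 \<phi>"
  show cont: "continuous_on {t0 - \<tau>..} ?h" by (rule continuous_on_delay_solution[OF assms(1,2)])
  have "{t \<in> {t0 - \<tau>..t0}. ?h t = 0} \<subseteq> (\<lambda>s. s + t0) ` {s \<in> {- \<tau>..0}. \<phi> s = 0}"
    by (force simp: image_iff delay_solution_initial intro!: exI[of _ "_ - t0"])
  then show "finite {t \<in> {t0 - \<tau>..t0}. ?h t = 0}" using assms(3) finite_surj by blast
  let ?g = "\<lambda>s. - sgn (?h (s - \<tau>)) + c * cos (2 * pi * s)"
  show "(?g has_integral (?h v - ?h u)) {u..v}" if "t0 \<le> u" "u \<le> v" for u v
  proof -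
    have int: "?g integrable_on {a..b}" if "t0 \<le> a" for a b
      using that by (intro relay_integrable continuous_on_subset[OF cont]) auto
    have "?h v - ?h u = integral {u..v} ?g"
      using delay_solution_eq[OF assms(1), of t0 u c \<phi>] delay_solution_eq[OF assms(1), of t0 v c \<phi>]
        Henstock_Kurzweil_Integration.integral_combine[OF that int] that by simp
    then show ?thesis using int[OF that(1)] by (simp add: has_integral_integrable_integral)
  qed
qed (fact assms)

text \<open>The equation can fail only one delay after a zero of \<open>h\<close>. Zeros are finite
  in number on bounded intervals, so these times form a countable null set; absolute continuity
  comes from the Lipschitz bound.\<close>

lemma (in relay_equation) is_solution:
  assumes "\<And>t. t \<in> {t0 - \<tau>..t0} \<Longrightarrow> h t = \<phi> (t - t0)"
  shows "is_solution c \<tau> t0 \<phi> h"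
  unfolding is_solution_def
proof (intro conjI allI impI ballI)
  show "continuous_on {t0..} h"
    using tau_pos by (auto intro: continuous_on_subset[OF cont])
  show "abs_cont_on_interval h t0 T" for T
    by (rule abs_cont_on_interval_lipschitz) (rule lipschitz)
  let ?Z = "{t. t > t0 \<and> h (t - \<tau>) = 0}"
  have "?Z \<subseteq> (\<Union>n. (\<lambda>t. t + \<tau>) ` {t \<in> {t0 - \<tau>..real n}. h t = 0})"
  proof
    fix t assume t: "t \<in> ?Z"
    obtain n where "t - \<tau> \<le> real n" using real_arch_simple by blast
    then show "t \<in> (\<Union>n. (\<lambda>t. t + \<tau>) ` {t \<in> {t0 - \<tau>..real n}. h t = 0})"
      using t by (intro UN_I[of n] image_eqI[of _ _ "t - \<tau>"]) auto
  qed
  then have "countable ?Z"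
    by (rule countable_subset)
       (rule countable_UN[OF countableI_type countable_image[OF countable_finite[OF finite_zeros]]])
  then have "?Z \<in> null_sets lebesgue"
    by (intro null_sets_completionI countable_imp_null_set_lborel)
  then show "AE t in lebesgue. t > t0 \<longrightarrow>
      (h has_real_derivative (- sgn (h (t - \<tau>)) + c * cos (2 * pi * t))) (at t)"
    by (rule AE_I') (use has_derivative_off_zeros in auto)
qed (fact assms)

section \<open>Uniqueness\<close>

text \<open>Agreement up to \<open>t0 + real n * \<tau>\<close> makes the delayed signs agree for
  one more delay. There \<open>k - h\<close> is absolutely continuous with derivative zero almost
  everywhere, hence keeps its value 0 from \<open>t0\<close>.\<close>

lemma is_solution_unique:
  assumes "\<tau> > 0" "is_solution c \<tau> t0 \<phi> h" "is_solution c \<tau> t0 \<phi> k" "t \<ge> t0 - \<tau>"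
  shows "k t = h t"
proof -
  have init: "k t = h t" if "t \<in> {t0 - \<tau>..t0}" for t
    using assms(2,3) that by (simp add: is_solution_def)
  have "AE t in lebesgue. t > t0 \<longrightarrow>
      (h has_real_derivative (- sgn (h (t - \<tau>)) + c * cos (2 * pi * t))) (at t) \<and>
      (k has_real_derivative (- sgn (k (t - \<tau>)) + c * cos (2 * pi * t))) (at t)"
    using assms(2,3) unfolding is_solution_def by (auto elim: AE_mp)
  then obtain N where N: "N \<in> null_sets lebesgue"
    and der: "\<And>t. t > t0 \<Longrightarrow> t \<notin> N \<Longrightarrow>
      (h has_real_derivative (- sgn (h (t - \<tau>)) + c * cos (2 * pi * t))) (at t) \<and>
      (k has_real_derivative (- sgn (k (t - \<tau>)) + c * cos (2 * pi * t))) (at t)"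
    by (auto elim!: AE_E3)
  have step: "\<forall>t\<in>{t0 - \<tau>..t0 + real n * \<tau>}. k t = h t" for n
  proof (induction n)
    case 0
    then show ?case using init by simp
  next
    case (Suc n)
    show ?case
    proof
      fix t assume t: "t \<in> {t0 - \<tau>..t0 + real (Suc n) * \<tau>}"
      show "k t = h t"
      proof (cases "t \<le> t0")
        case True
        then show ?thesis using init t by simp
      next
        case False
        then have ac: "abs_cont_on_interval (\<lambda>x. k x - h x) t0 t"
          using assms(2,3) by (intro abs_cont_on_interval_diff) (auto simp: is_solution_def)
        have "k t - h t = k t0 - h t0"
        proof (rule abs_cont_zero_derivative_imp_eq[OF ac])
          \<comment> \<open>The point \<open>t0\<close> joins the exceptional set because the
            equation is known only for \<open>t > t0\<close>.\<close>
          show "negligible (insert t0 N)" using N by (simp add: negligible_iff_null_sets)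
          fix x assume x: "x \<in> {t0..t} - insert t0 N"
          then have "k (x - \<tau>) = h (x - \<tau>)"
            using Suc t by (auto simp: algebra_simps)
          then show "((\<lambda>x. k x - h x) has_real_derivative 0) (at x)"
            using der[of x] x DERIV_diff[of k _ x UNIV h] by fastforce
        qed (use False in simp)
        then show ?thesis using init[of t0] assms(1) by simp
      qed
    qed
  qed
  obtain n where "t - t0 < real n * \<tau>" using reals_Archimedean3[OF assms(1)] by blast
  then show ?thesis using step[of n] assms(4) by auto
qed

theorem theorem2p1:
  fixes c \<tau> t0 :: real and \<phi> :: "real \<Rightarrow> real"
  assumes "c \<ge> 0" and "\<tau> > 0"
    and "continuous_on {-\<tau>..0} \<phi>"
    and "finite {s \<in> {-\<tau>..0}. \<phi> s = 0}"
  shows "\<exists>h. is_solution c \<tau> t0 \<phi> h \<and>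
           (\<forall>k. is_solution c \<tau> t0 \<phi> k \<longrightarrow> (\<forall>t\<ge>t0 - \<tau>. k t = h t)) \<and>
           continuous_on {t0..} h \<and>
           bounded (h ` {t0..}) \<and>
           infinite {z. z > t0 \<and> crosses_zero_at h z}"
proof -
  let ?h = "delay_solution c \<tau> t0 \<phi>"
  interpret relay_equation c \<tau> t0 ?h
    by (rule relay_equation_delay_solution[OF assms(2-4)])
  have sol: "is_solution c \<tau> t0 \<phi> ?h" by (rule is_solution) (simp add: delay_solution_initial)
  then have "continuous_on {t0..} ?h" by (simp add: is_solution_def)
  with sol show ?thesis
    using is_solution_unique[OF assms(2) sol] bounded_solution infinitely_many_crossings by blast
qed

end
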